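(* Let $\mathbf{A}=[\underline{A},\overline{A}]$ be an $n\times n$ real interval matrix that is totally positive. Then $\sigma_{\min}(\mathbf{A})=[\sigma_{\min}(\downarrow A),\sigma_{\min}(\uparrow A)]$ and $\sigma_{\max}(\mathbf{A})=[\sigma_{\max}(\underline{A}),\sigma_{\max}(\overline{A})]$.
   Context: Inequalities between matrices are entrywise. For $\underline{A}\le\overline{A}$ in $\mathbb{R}^{n\times n}$, the interval matrix is $\mathbf{A}=\{A\in\mathbb{R}^{n\times n} : \underline{A}\le A\le\overline{A}\}$, with midpoint $A^c=\frac12(\underline{A}+\overline{A})$ and radius $A^\Delta=\frac12(\overline{A}-\underline{A})$. A matrix in $\mathbb{R}^{n\times n}$ is totally positive if the determinants of all its square submatrices (all minors) are positive; $\mathbf{A}$ is totally positive if every $A\in\mathbf{A}$ is. Let $s=(1,-1,1,-1,\dots)^T\in\mathbb{R}^n$, let $\operatorname{diag}(s)$ be the diagonal matrix with diagonal $s$, and put $\downarrow A=A^c-\operatorname{diag}(s)A^\Delta\operatorname{diag}(s)$, $\uparrow A=A^c+\operatorname{diag}(s)A^\Delta\operatorname{diag}(s)$. $\sigma_{\min}(A)$ and $\sigma_{\max}(A)$ are the smallest and largest singular values of $A$, and for a real function $f$ on matrices, $f(\mathbf{A})=\{f(A) : A\in\mathbf{A}\}$. *)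

theory Defs
  imports
    Complex_Main
    "Jordan_Normal_Form.Char_Poly"
    "Jordan_Normal_Form.DL_Submatrix"
begin

(* The order on the type mat is entrywise and includes equality of dimensions, so for
   L, U in carrier_mat n n the set {L..U} is exactly the interval matrix [L, U]. *)

definition mid_mat :: "real mat \<Rightarrow> real mat \<Rightarrow> real mat" where
  "mid_mat L U = (1/2) \<cdot>\<^sub>m (L + U)"

definition rad_mat :: "real mat \<Rightarrow> real mat \<Rightarrow> real mat" where
  "rad_mat L U = (1/2) \<cdot>\<^sub>m (U - L)"

(* Indices start at 0, so the diagonal is 1, -1, 1, -1, ... *)
definition sign_mat :: "nat \<Rightarrow> real mat" where
  "sign_mat n = mat_diag n (\<lambda>i. (-1) ^ i)"

definition down_mat :: "real mat \<Rightarrow> real mat \<Rightarrow> real mat" where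
  "down_mat L U =
     mid_mat L U - sign_mat (dim_row L) * rad_mat L U * sign_mat (dim_col L)"

definition up_mat :: "real mat \<Rightarrow> real mat \<Rightarrow> real mat" where
  "up_mat L U =
     mid_mat L U + sign_mat (dim_row L) * rad_mat L U * sign_mat (dim_col L)"

definition totally_positive :: "real mat \<Rightarrow> bool" where
  "totally_positive A \<longleftrightarrow>
     (\<forall>I J. I \<subseteq> {..<dim_row A} \<and> J \<subseteq> {..<dim_col A} \<and> I \<noteq> {} \<and> card I = card J
        \<longrightarrow> det (submatrix A I J) > 0)"

(* Intended for square matrices: if A has more columns than rows, then 0 is always an
   eigenvalue of the transpose of A times A, although it need not be a singular value of A. *)
definition singular_values :: "real mat \<Rightarrow> real set" where
  "singular_values A = sqrt ` {k. eigenvalue (transpose_mat A * A) k}"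

definition sigma_min :: "real mat \<Rightarrow> real" where
  "sigma_min A = Min (singular_values A)"

definition sigma_max :: "real mat \<Rightarrow> real" where
  "sigma_max A = Max (singular_values A)"

end

theory Submission
  imports Defs "HOL-Analysis.Function_Topology" "HOL-Analysis.L2_Norm"
begin

text \<open>
  Extremal singular values are extrema of \<open>\<parallel>A x\<parallel>\<close> over unit vectors. Hence \<open>\<sigma>\<^sub>m\<^sub>a\<^sub>x\<close> is monotone on
  entrywise nonnegative matrices. By Cramer's rule the inverse of a totally positive matrix has
  checkerboard signs, and \<open>B\<inverse> - C\<inverse> = B\<inverse> (C - B) C\<inverse>\<close>, so if \<open>C - B\<close> has checkerboard signs as
  well, passing from \<open>B\<close> to \<open>C\<close> shrinks the entries of the inverse in modulus and increases
  \<open>\<sigma>\<^sub>m\<^sub>i\<^sub>n\<close>. The matrices \<open>\<down>A\<close> and \<open>\<up>A\<close> are the extreme points of the interval matrix for this checkerboard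
  order. Both functions are Lipschitz along segments, so the intermediate value theorem shows
  that every value between the extremes is attained.
\<close>

section \<open>The Euclidean norm\<close>

text \<open>Building on \<open>L2_set\<close> makes its triangle inequality available, which the
  perturbation bounds rest on.\<close>

definition l2norm :: "real vec \<Rightarrow> real" where
  "l2norm v = L2_set (($) v) {..<dim_vec v}"

lemma l2norm_nonneg [simp]: "0 \<le> l2norm v"
  by (simp add: l2norm_def)

lemma l2norm_power2: "(l2norm v)\<^sup>2 = v \<bullet> v"
  by (simp add: l2norm_def L2_set_def sum_nonneg scalar_prod_def power2_eq_square lessThan_atLeast0)

lemma l2norm_eq_0_iff: "l2norm v = 0 \<longleftrightarrow> v = 0\<^sub>v (dim_vec v)"
  by (auto simp: l2norm_def L2_set_eq_0_iff vec_eq_iff)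

lemma l2norm_smult: "l2norm (c \<cdot>\<^sub>v v) = \<bar>c\<bar> * l2norm v"
proof -
  have "(l2norm (c \<cdot>\<^sub>v v))\<^sup>2 = (\<bar>c\<bar> * l2norm v)\<^sup>2"
    by (simp add: l2norm_power2 power_mult_distrib) (simp add: power2_eq_square)
  then show ?thesis
    by (simp add: power2_eq_iff_nonneg)
qed

lemma l2norm_mono:
  assumes "dim_vec v = dim_vec w" "\<And>i. i < dim_vec w \<Longrightarrow> \<bar>v $ i\<bar> \<le> \<bar>w $ i\<bar>"
  shows "l2norm v \<le> l2norm w"
  unfolding l2norm_def L2_set_def using assms
  by (auto intro!: sum_mono simp: abs_le_square_iff)

lemma l2norm_cong_abs:
  assumes "dim_vec v = dim_vec w" "\<And>i. i < dim_vec w \<Longrightarrow> \<bar>v $ i\<bar> = \<bar>w $ i\<bar>"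
  shows "l2norm v = l2norm w"
  using assms by (intro antisym l2norm_mono) auto

lemma l2norm_triangle:
  assumes "v \<in> carrier_vec n" "w \<in> carrier_vec n"
  shows "l2norm (v + w) \<le> l2norm v + l2norm w"
proof -
  have "l2norm (v + w) = L2_set (\<lambda>i. v $ i + w $ i) {..<n}"
    using assms by (auto simp: l2norm_def intro!: L2_set_cong)
  then show ?thesis
    using L2_set_triangle_ineq[of "($) v" "($) w" "{..<n}"] assms by (simp add: l2norm_def)
qed

section \<open>Extremal singular values as extrema over vectors\<close>

text \<open>A continuous function attains its minimum on the compact unit sphere; since both sides
  are homogeneous of degree two in \<open>y\<close>, the bound extends from unit vectors to all
  vectors.\<close>

lemma quadratic_form_minimizer:
  fixes H :: "real mat"
  assumes "0 < n" "H \<in> carrier_mat n n"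
  obtains x where "x \<in> carrier_vec n" "x \<bullet> x = 1"
    "\<And>y. y \<in> carrier_vec n \<Longrightarrow> (x \<bullet> (H *\<^sub>v x)) * (y \<bullet> y) \<le> y \<bullet> (H *\<^sub>v y)"
proof -
  define q where "q f = (\<Sum>i<n. \<Sum>j<n. f i * H $$ (i,j) * f j)" for f :: "nat \<Rightarrow> real"
  define r where "r f = (\<Sum>i<n. (f i)\<^sup>2)" for f :: "nat \<Rightarrow> real"
  \<comment> \<open>Vectors are modelled as functions on all of \<open>nat\<close> with the
    coordinates from \<open>n\<close> on pinned to 0, so the box is compact by Tychonoff's theorem,
    and \<open>K\<close>, the unit sphere, is a closed part of it.\<close>
  define B :: "nat \<Rightarrow> real set" where "B i = (if i < n then {-1..1} else {0})" for i
  define K where "K = Pi\<^sub>E UNIV B \<inter> {f. r f = 1}"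
  have q: "vec n f \<bullet> (H *\<^sub>v vec n f) = q f" for f
    using assms(2)
    by (auto simp: q_def scalar_prod_def lessThan_atLeast0 sum_distrib_left mult.assoc intro!: sum.cong)
  have r: "vec n f \<bullet> vec n f = r f" for f
    by (simp add: r_def scalar_prod_def lessThan_atLeast0 power2_eq_square)
  have proj: "continuous_on UNIV (\<lambda>f::nat \<Rightarrow> real. f i)" for i
    by (rule continuous_on_product_coordinates)
  have cont: "continuous_on UNIV q" "continuous_on UNIV r"
    unfolding q_def r_def by (intro continuous_intros proj)+
  have "compact (Pi\<^sub>E UNIV B)"
    unfolding compactin_euclidean_iff[symmetric] euclidean_product_topology[symmetric]
    by (auto simp: compactin_PiE B_def)
  then have "compact K"
    unfolding K_def by (intro compact_Int_closed closed_Collect_eq cont continuous_on_const)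
  moreover have "K \<noteq> {}"
  proof -
    have "r (\<lambda>i. if i = 0 then 1 else 0) = 1"
      using assms(1) by (simp add: r_def if_distrib[of "\<lambda>x. x\<^sup>2"] cong: if_cong)
    then have "(\<lambda>i. if i = 0 then 1 else 0) \<in> K"
      using assms(1) by (auto simp: K_def B_def)
    then show ?thesis by blast
  qed
  ultimately obtain f where f: "f \<in> K" "\<And>g. g \<in> K \<Longrightarrow> q f \<le> q g"
    using continuous_attains_inf[of K q] cont(1) continuous_on_subset by blast
  show thesis
  proof
    show "vec n f \<in> carrier_vec n" by simp
    show "vec n f \<bullet> vec n f = 1" using f(1) by (simp add: r K_def)
    fix y :: "real vec" assume y: "y \<in> carrier_vec n"
    show "(vec n f \<bullet> (H *\<^sub>v vec n f)) * (y \<bullet> y) \<le> y \<bullet> (H *\<^sub>v y)"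
    proof (cases "l2norm y = 0")
      case True
      then have "y = 0\<^sub>v n" using y by (simp add: l2norm_eq_0_iff)
      then show ?thesis using assms(2) by simp
    next
      case False
      then have pos: "l2norm y > 0" using l2norm_nonneg[of y] by linarith
      define g where "g i = (if i < n then y $ i / l2norm y else 0)" for i
      have ry: "(l2norm y)\<^sup>2 = (\<Sum>i<n. (y $ i)\<^sup>2)"
        using y by (simp add: l2norm_def L2_set_def sum_nonneg)
      have rg: "r g = 1"
        using pos unfolding r_def g_def
        by (simp add: power_divide flip: sum_divide_distrib ry)
      have "(g i)\<^sup>2 \<le> r g" if "i < n" for i
        unfolding r_def using that by (intro member_le_sum) auto
      then have "\<bar>g i\<bar> \<le> 1" if "i < n" for i
        using that rg by (simp add: abs_square_le_1)
      then have "g \<in> K"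
        using rg by (auto simp: K_def B_def abs_le_iff minus_le_iff) (simp add: g_def)
      then have le: "q f \<le> q g" by (rule f(2))
      have "vec n (($) y) = y" using y by auto
      then have "y \<bullet> (H *\<^sub>v y) = q (($) y)" using q[of "($) y"] by simp
      also have "q (($) y) = q g * (l2norm y)\<^sup>2"
        using pos unfolding q_def g_def sum_distrib_right
        by (intro sum.cong) (auto simp: power2_eq_square)
      finally show ?thesis
        using le by (simp add: q l2norm_power2[symmetric] mult_right_mono)
    qed
  qed
qed

text \<open>A minimizer \<open>x\<close> of the quadratic form on the unit sphere, with minimum
  \<open>k\<close>, is an eigenvector: if the residual \<open>z\<close> of the eigenvalue equation
  were nonzero, moving from \<open>x\<close> in the direction \<open>-z\<close> would violate
  minimality.\<close>

lemma symmetric_least_eigenvalue: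
  fixes H :: "real mat"
  assumes "0 < n" and H: "H \<in> carrier_mat n n" and sym: "transpose_mat H = H"
  obtains k where "eigenvalue H k"
    "\<And>y. y \<in> carrier_vec n \<Longrightarrow> k * (y \<bullet> y) \<le> y \<bullet> (H *\<^sub>v y)"
proof -
  obtain x where x: "x \<in> carrier_vec n" "x \<bullet> x = 1" and
    le: "\<And>y. y \<in> carrier_vec n \<Longrightarrow> (x \<bullet> (H *\<^sub>v x)) * (y \<bullet> y) \<le> y \<bullet> (H *\<^sub>v y)"
    using quadratic_form_minimizer[OF assms(1) H] by blast
  define k where "k = x \<bullet> (H *\<^sub>v x)"
  define z where "z = H *\<^sub>v x - k \<cdot>\<^sub>v x"
  define p where "p = z \<bullet> (H *\<^sub>v z) - k * (z \<bullet> z)"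
  have z: "z \<in> carrier_vec n" using x H by (simp add: z_def)
  have p: "0 \<le> p" using le[OF z] by (simp add: p_def k_def)
  have Hx: "H *\<^sub>v x \<in> carrier_vec n" and Hz: "H *\<^sub>v z \<in> carrier_vec n" using x z H by auto
  have xHz: "x \<bullet> (H *\<^sub>v z) = z \<bullet> (H *\<^sub>v x)"
    using transpose_vec_mult_scalar[OF H z x(1)] sym comm_scalar_prod[OF Hx z] by simp
  have zx: "x \<bullet> z = z \<bullet> x" using comm_scalar_prod[OF x(1) z] .
  have zHx: "z \<bullet> (H *\<^sub>v x) = z \<bullet> z + k * (z \<bullet> x)"
    using scalar_prod_minus_distrib[OF z Hx, of "k \<cdot>\<^sub>v x"] z x by (simp flip: z_def)
  \<comment> \<open>Minimality is tested at \<open>x - t z\<close>. The constant terms cancel, and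
    by symmetry of \<open>H\<close> both cross terms are equal and combine to the linear
    coefficient.\<close>
  have expand: "0 \<le> t\<^sup>2 * p - 2 * t * (z \<bullet> z)" for t
  proof -
    have y: "x - t \<cdot>\<^sub>v z \<in> carrier_vec n" using x z by simp
    have "H *\<^sub>v (x - t \<cdot>\<^sub>v z) = H *\<^sub>v x - t \<cdot>\<^sub>v (H *\<^sub>v z)"
      using H x z by (simp add: mult_minus_distrib_mat_vec mult_mat_vec)
    then have q: "(x - t \<cdot>\<^sub>v z) \<bullet> (H *\<^sub>v (x - t \<cdot>\<^sub>v z))
        = k - t * (x \<bullet> (H *\<^sub>v z)) - t * (z \<bullet> (H *\<^sub>v x)) + t * t * (z \<bullet> (H *\<^sub>v z))"
      using x z Hx Hz
      by (simp add: k_def scalar_prod_minus_distrib[of _ n] minus_scalar_prod_distrib[of _ n] algebra_simps)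
    have r: "(x - t \<cdot>\<^sub>v z) \<bullet> (x - t \<cdot>\<^sub>v z) = 1 - t * (x \<bullet> z) - t * (z \<bullet> x) + t * t * (z \<bullet> z)"
      using x z
      by (simp add: scalar_prod_minus_distrib[of _ n] minus_scalar_prod_distrib[of _ n] algebra_simps)
    show ?thesis
      using le[OF y] unfolding k_def[symmetric] q r xHz zx zHx p_def
      by (simp add: algebra_simps power2_eq_square)
  qed
  have "z \<bullet> z = 0"
  proof (rule ccontr)
    assume "z \<bullet> z \<noteq> 0"
    then have a: "0 < z \<bullet> z" using l2norm_power2[of z] by (metis less_le zero_le_power2)
    \<comment> \<open>The parabola in \<open>expand\<close> vanishes at 0 with negative slope, so it
      takes negative values: at \<open>t = 1\<close> if it is linear, otherwise at its vertex
      \<open>t = (z \<bullet> z) / p\<close>.\<close>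
    show False
    proof (cases "p = 0")
      case True
      then show ?thesis using expand[of 1] a by simp
    next
      case False
      then have "(z \<bullet> z / p)\<^sup>2 * p - 2 * (z \<bullet> z / p) * (z \<bullet> z) = - ((z \<bullet> z)\<^sup>2 / p)"
        by (simp add: power2_eq_square field_simps)
      moreover have "(z \<bullet> z)\<^sup>2 / p > 0" using a p False by simp
      ultimately show ?thesis using expand[of "z \<bullet> z / p"] by linarith
    qed
  qed
  then have "z = 0\<^sub>v n"
    using z l2norm_eq_0_iff[of z] l2norm_power2[of z] by simp
  then have "H *\<^sub>v x = k \<cdot>\<^sub>v x"
    using H Hx x unfolding z_def by (intro eq_vecI) (auto simp: vec_eq_iff)
  moreover have "x \<noteq> 0\<^sub>v n" using x by auto
  ultimately have "eigenvalue H k"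
    using x H by (auto simp: eigenvalue_def eigenvector_def)
  then show thesis using le that unfolding k_def by blast
qed


lemma gram_form:
  fixes A :: "real mat"
  assumes "A \<in> carrier_mat n n" "x \<in> carrier_vec n"
  shows "x \<bullet> (transpose_mat A * A *\<^sub>v x) = (l2norm (A *\<^sub>v x))\<^sup>2"
proof -
  have Ax: "A *\<^sub>v x \<in> carrier_vec n" using assms by simp
  have "x \<bullet> (transpose_mat A *\<^sub>v (A *\<^sub>v x)) = (transpose_mat A *\<^sub>v (A *\<^sub>v x)) \<bullet> x"
    using assms Ax by (intro comm_scalar_prod[of _ n]) auto
  also have "\<dots> = (A *\<^sub>v x) \<bullet> (A *\<^sub>v x)"
    using transpose_vec_mult_scalar[OF assms Ax] by simp
  finally show ?thesis
    using assms by (simp add: l2norm_power2 assoc_mult_mat_vec[of _ n n _ n])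
qed

text \<open>The characteristic polynomial is monic, hence nonzero, and has finitely many roots.
  Finiteness gives \<open>Min\<close> and \<open>Max\<close> in \<open>sigma_min\<close> and
  \<open>sigma_max\<close> their meaning.\<close>

lemma finite_singular_values:
  assumes "A \<in> carrier_mat n n"
  shows "finite (singular_values A)"
proof -
  have H: "transpose_mat A * A \<in> carrier_mat n n" using assms by simp
  then have "char_poly (transpose_mat A * A) \<noteq> 0"
    using degree_monic_char_poly[OF H] by auto
  then have "finite {k. poly (char_poly (transpose_mat A * A)) k = 0}"
    by (rule poly_roots_finite)
  then show ?thesis
    unfolding singular_values_def eigenvalue_root_char_poly[OF H] by (rule finite_imageI)
qed

lemma singular_value_vector:
  assumes A: "A \<in> carrier_mat n n" and "s \<in> singular_values A"
  obtains x where "x \<in> carrier_vec n" "l2norm x = 1" "l2norm (A *\<^sub>v x) = s"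
proof -
  obtain k v where s: "s = sqrt k" and v: "v \<in> carrier_vec n" "v \<noteq> 0\<^sub>v n"
    "transpose_mat A * A *\<^sub>v v = k \<cdot>\<^sub>v v"
    using assms by (auto simp: singular_values_def eigenvalue_def eigenvector_def)
  have pos: "0 < l2norm v"
    using v l2norm_eq_0_iff[of v] l2norm_nonneg[of v] by (simp add: less_le)
  have "(l2norm (A *\<^sub>v v))\<^sup>2 = k * (l2norm v)\<^sup>2"
    using gram_form[OF A v(1)] v by (simp add: l2norm_power2)
  \<comment> \<open>\<open>sqrt\<close> is multiplicative on all reals, negative ones included, so
    roots can be taken without settling the sign of \<open>k\<close>.\<close>
  then have "l2norm (A *\<^sub>v v) = s * l2norm v"
    by (metis s l2norm_nonneg real_sqrt_mult real_sqrt_abs abs_of_nonneg)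
  then show thesis
    using pos v(1) A that[of "(1 / l2norm v) \<cdot>\<^sub>v v"]
    by (simp add: l2norm_smult mult_mat_vec)
qed

lemma least_singular_value:
  assumes "0 < n" and A: "A \<in> carrier_mat n n"
  obtains s where "s \<in> singular_values A"
    "\<And>x. x \<in> carrier_vec n \<Longrightarrow> s * l2norm x \<le> l2norm (A *\<^sub>v x)"
proof -
  have "transpose_mat (transpose_mat A * A) = transpose_mat A * A"
    using A by (simp add: transpose_mult[of _ n n _ n])
  then obtain k where k: "eigenvalue (transpose_mat A * A) k"
    "\<And>y. y \<in> carrier_vec n \<Longrightarrow> k * (y \<bullet> y) \<le> y \<bullet> (transpose_mat A * A *\<^sub>v y)"
    using symmetric_least_eigenvalue[OF assms(1), of "transpose_mat A * A"] A by auto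
  show thesis
  proof
    show "sqrt k \<in> singular_values A" using k(1) by (simp add: singular_values_def)
    fix x :: "real vec" assume x: "x \<in> carrier_vec n"
    have "k * (l2norm x)\<^sup>2 \<le> (l2norm (A *\<^sub>v x))\<^sup>2"
      using k(2)[OF x] gram_form[OF A x] by (simp add: l2norm_power2)
    then have "sqrt (k * (l2norm x)\<^sup>2) \<le> sqrt ((l2norm (A *\<^sub>v x))\<^sup>2)"
      by (rule real_sqrt_le_mono)
    then show "sqrt k * l2norm x \<le> l2norm (A *\<^sub>v x)"
      by (simp add: real_sqrt_mult)
  qed
qed

text \<open>The least eigenvalue of the negated Gram matrix is the negative of the greatest
  eigenvalue of the Gram matrix.\<close>

lemma greatest_singular_value:
  assumes "0 < n" and A: "A \<in> carrier_mat n n"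
  obtains s where "s \<in> singular_values A"
    "\<And>x. x \<in> carrier_vec n \<Longrightarrow> l2norm (A *\<^sub>v x) \<le> s * l2norm x"
proof -
  define H where "H = transpose_mat A * A"
  have H: "H \<in> carrier_mat n n" using A by (simp add: H_def)
  have neg: "(- H) *\<^sub>v y = - (H *\<^sub>v y)" if "y \<in> carrier_vec n" for y
    using H that by (intro eq_vecI) (auto simp: scalar_prod_def sum_negf)
  have "transpose_mat (- H) = - H"
    using A by (simp add: H_def transpose_mult[of _ n n _ n] transpose_uminus)
  then obtain k where k: "eigenvalue (- H) k"
    "\<And>y. y \<in> carrier_vec n \<Longrightarrow> k * (y \<bullet> y) \<le> y \<bullet> ((- H) *\<^sub>v y)"
    using symmetric_least_eigenvalue[OF assms(1), of "- H"] H by auto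
  obtain v where v: "v \<in> carrier_vec n" "v \<noteq> 0\<^sub>v n" "(- H) *\<^sub>v v = k \<cdot>\<^sub>v v"
    using k(1) H by (auto simp: eigenvalue_def eigenvector_def)
  then have "H *\<^sub>v v = (- k) \<cdot>\<^sub>v v"
    using neg[OF v(1)] H by (auto simp: vec_eq_iff)
  then have ev: "eigenvalue H (- k)"
    using v H by (auto simp: eigenvalue_def eigenvector_def)
  show thesis
  proof
    show "sqrt (- k) \<in> singular_values A" using ev by (simp add: singular_values_def H_def)
    fix x :: "real vec" assume x: "x \<in> carrier_vec n"
    have "(l2norm (A *\<^sub>v x))\<^sup>2 \<le> (- k) * (l2norm x)\<^sup>2"
      using k(2)[OF x] gram_form[OF A x] neg[OF x] x A by (simp add: l2norm_power2 H_def)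
    then have "sqrt ((l2norm (A *\<^sub>v x))\<^sup>2) \<le> sqrt ((- k) * (l2norm x)\<^sup>2)"
      by (rule real_sqrt_le_mono)
    then show "l2norm (A *\<^sub>v x) \<le> sqrt (- k) * l2norm x"
      by (simp only: real_sqrt_mult real_sqrt_abs abs_of_nonneg l2norm_nonneg)
  qed
qed

lemma sigma_min_le:
  assumes "0 < n" "A \<in> carrier_mat n n" "x \<in> carrier_vec n"
  shows "sigma_min A * l2norm x \<le> l2norm (A *\<^sub>v x)"
proof -
  obtain s where s: "s \<in> singular_values A"
    "\<And>x. x \<in> carrier_vec n \<Longrightarrow> s * l2norm x \<le> l2norm (A *\<^sub>v x)"
    using least_singular_value[OF assms(1,2)] by blast
  have "sigma_min A \<le> s"
    unfolding sigma_min_def using finite_singular_values[OF assms(2)] s(1) by simp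
  then show ?thesis
    using s(2)[OF assms(3)] mult_right_mono[of "sigma_min A" s "l2norm x"] by simp
qed

lemma le_sigma_max:
  assumes "0 < n" "A \<in> carrier_mat n n" "x \<in> carrier_vec n"
  shows "l2norm (A *\<^sub>v x) \<le> sigma_max A * l2norm x"
proof -
  obtain s where s: "s \<in> singular_values A"
    "\<And>x. x \<in> carrier_vec n \<Longrightarrow> l2norm (A *\<^sub>v x) \<le> s * l2norm x"
    using greatest_singular_value[OF assms(1,2)] by blast
  have "s \<le> sigma_max A"
    unfolding sigma_max_def using finite_singular_values[OF assms(2)] s(1) by simp
  then show ?thesis
    using s(2)[OF assms(3)] mult_right_mono[of s "sigma_max A" "l2norm x"] by simp
qed

text \<open>With \<open>sigma_min_le\<close> this characterizes \<open>sigma_min A\<close> as a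
  minimum over unit vectors. The later arguments use only this description and its analogue for
  \<open>sigma_max\<close>.\<close>

lemma sigma_min_vector:
  assumes "0 < n" "A \<in> carrier_mat n n"
  obtains x where "x \<in> carrier_vec n" "l2norm x = 1" "l2norm (A *\<^sub>v x) = sigma_min A"
proof -
  have "singular_values A \<noteq> {}" using least_singular_value[OF assms] by blast
  then have "sigma_min A \<in> singular_values A"
    unfolding sigma_min_def using finite_singular_values[OF assms(2)] by simp
  then show thesis using singular_value_vector[OF assms(2)] that by blast
qed

lemma sigma_max_vector:
  assumes "0 < n" "A \<in> carrier_mat n n"
  obtains x where "x \<in> carrier_vec n" "l2norm x = 1" "l2norm (A *\<^sub>v x) = sigma_max A"
proof -
  have "singular_values A \<noteq> {}" using least_singular_value[OF assms] by blast
  then have "sigma_max A \<in> singular_values A"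
    unfolding sigma_max_def using finite_singular_values[OF assms(2)] by simp
  then show thesis using singular_value_vector[OF assms(2)] that by blast
qed

section \<open>Continuity along segments\<close>

lemma sigma_max_add_le:
  assumes "0 < n" "A \<in> carrier_mat n n" "D \<in> carrier_mat n n"
  shows "sigma_max (A + D) \<le> sigma_max A + sigma_max D"
proof -
  have AD: "A + D \<in> carrier_mat n n" using assms by simp
  obtain x where x: "x \<in> carrier_vec n" "l2norm x = 1" "l2norm ((A + D) *\<^sub>v x) = sigma_max (A + D)"
    using sigma_max_vector[OF assms(1) AD] .
  have "l2norm ((A + D) *\<^sub>v x) \<le> l2norm (A *\<^sub>v x) + l2norm (D *\<^sub>v x)"
    unfolding add_mult_distrib_mat_vec[OF assms(2,3) x(1)]
    using assms x by (intro l2norm_triangle[of _ n]) auto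
  then show ?thesis
    using le_sigma_max[OF assms(1,2) x(1)] le_sigma_max[OF assms(1,3) x(1)] x(2,3) by simp
qed

text \<open>A Weyl-type bound: a minimizing unit vector of \<open>A\<close>, not of
  \<open>A + D\<close>, serves as test vector, and \<open>D\<close> lengthens its image by at most
  \<open>sigma_max D\<close>.\<close>

lemma sigma_min_add_le:
  assumes "0 < n" "A \<in> carrier_mat n n" "D \<in> carrier_mat n n"
  shows "sigma_min (A + D) \<le> sigma_min A + sigma_max D"
proof -
  have AD: "A + D \<in> carrier_mat n n" using assms by simp
  obtain x where x: "x \<in> carrier_vec n" "l2norm x = 1" "l2norm (A *\<^sub>v x) = sigma_min A"
    using sigma_min_vector[OF assms(1,2)] .
  have "l2norm ((A + D) *\<^sub>v x) \<le> l2norm (A *\<^sub>v x) + l2norm (D *\<^sub>v x)"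
    unfolding add_mult_distrib_mat_vec[OF assms(2,3) x(1)]
    using assms x by (intro l2norm_triangle[of _ n]) auto
  then show ?thesis
    using sigma_min_le[OF assms(1) AD x(1)] le_sigma_max[OF assms(1,3) x(1)] x(2,3) by simp
qed

lemma sigma_max_smult_le:
  assumes "0 < n" "D \<in> carrier_mat n n"
  shows "sigma_max (c \<cdot>\<^sub>m D) \<le> \<bar>c\<bar> * sigma_max D"
proof -
  have cD: "c \<cdot>\<^sub>m D \<in> carrier_mat n n" using assms by simp
  obtain x where x: "x \<in> carrier_vec n" "l2norm x = 1" "l2norm ((c \<cdot>\<^sub>m D) *\<^sub>v x) = sigma_max (c \<cdot>\<^sub>m D)"
    using sigma_max_vector[OF assms(1) cD] .
  have "(c \<cdot>\<^sub>m D) *\<^sub>v x = c \<cdot>\<^sub>v (D *\<^sub>v x)"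
    using assms x by (intro eq_vecI) auto
  then show ?thesis
    using x le_sigma_max[OF assms x(1)] by (metis abs_ge_zero l2norm_smult mult.right_neutral mult_left_mono)
qed

text \<open>The one-sided bound on \<open>f\<close>, applied in both directions between two points
  of the segment, makes \<open>f\<close> Lipschitz there, so the intermediate value theorem
  applies.\<close>

lemma segment_intermediate_value:
  fixes f :: "real mat \<Rightarrow> real"
  assumes "0 < n" and A: "A \<in> carrier_mat n n" and B: "B \<in> carrier_mat n n"
    and f: "\<And>X D. X \<in> carrier_mat n n \<Longrightarrow> D \<in> carrier_mat n n \<Longrightarrow> f (X + D) \<le> f X + sigma_max D"
    and y: "f A \<le> y" "y \<le> f B"
  obtains t where "0 \<le> t" "t \<le> 1" "f (A + t \<cdot>\<^sub>m (B - A)) = y"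
proof -
  define D where "D = B - A"
  define g where "g t = f (A + t \<cdot>\<^sub>m D)" for t
  define M where "M = sigma_max D"
  have D: "D \<in> carrier_mat n n" using A B by (simp add: D_def minus_carrier_mat)
  have le: "g t \<le> g s + \<bar>t - s\<bar> * M" for s t
  proof -
    have "A + t \<cdot>\<^sub>m D = (A + s \<cdot>\<^sub>m D) + (t - s) \<cdot>\<^sub>m D"
      using A D by (intro eq_matI) (auto simp: algebra_simps)
    then have "g t \<le> g s + sigma_max ((t - s) \<cdot>\<^sub>m D)"
      using f[of "A + s \<cdot>\<^sub>m D" "(t - s) \<cdot>\<^sub>m D"] A D by (simp add: g_def)
    then show ?thesis
      using sigma_max_smult_le[OF assms(1) D, of "t - s"] by (simp add: M_def)
  qed
  have dist: "dist (g s) (g t) \<le> \<bar>M\<bar> * dist s t" for s t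
  proof -
    have "\<bar>t - s\<bar> * M \<le> \<bar>M\<bar> * dist s t"
      by (simp add: dist_real_def abs_minus_commute mult.commute[of "\<bar>M\<bar>"] mult_left_mono)
    then show ?thesis
      using le[of s t] le[of t s] by (auto simp: dist_real_def abs_minus_commute)
  qed
  have "isCont g s" for s
    unfolding isCont_def
  proof (rule metric_LIM_imp_LIM[where f = "\<lambda>t. \<bar>M\<bar> * dist t s" and l = 0])
    have "((\<lambda>t. \<bar>M\<bar> * dist t s) \<longlongrightarrow> \<bar>M\<bar> * dist s s) (at s)"
      by (intro tendsto_intros)
    then show "((\<lambda>t. \<bar>M\<bar> * dist t s) \<longlongrightarrow> 0) (at s)" by simp
  qed (use dist in auto)
  moreover have "A + 0 \<cdot>\<^sub>m D = A" "A + 1 \<cdot>\<^sub>m D = B"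
    using A B by (auto simp: D_def intro!: eq_matI)
  ultimately obtain t where "0 \<le> t" "t \<le> 1" "g t = y"
    using IVT[of g 0 y 1] y by (auto simp: g_def)
  then show thesis using that by (simp add: g_def D_def)
qed

section \<open>Images of interval matrices\<close>

lemma interval_mat_carrier:
  fixes L :: "real mat"
  assumes "A \<in> {L..U}" "L \<in> carrier_mat n m"
  shows "A \<in> carrier_mat n m"
  using assms unfolding atLeastAtMost_iff less_eq_mat_def by (intro carrier_matI) auto

lemma interval_mat_entry:
  fixes L :: "real mat"
  assumes "A \<in> {L..U}" "L \<in> carrier_mat n m" "i < n" "j < m"
  shows "L $$ (i,j) \<le> A $$ (i,j) \<and> A $$ (i,j) \<le> U $$ (i,j)"
proof -
  have "dim_row A = n" "dim_col A = m" using interval_mat_carrier[OF assms(1,2)] by auto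
  moreover have "L \<le> A" "A \<le> U" using assms(1) by auto
  ultimately show ?thesis using assms(3,4) by (simp add: less_eq_mat_def)
qed

text \<open>An interval matrix is convex, so the segment from \<open>A\<close> to \<open>B\<close>
  stays inside it and already realizes every value between the two extremes.\<close>

lemma image_interval_mat:
  fixes f :: "real mat \<Rightarrow> real"
  assumes "0 < n" and L: "L \<in> carrier_mat n n" and U: "U \<in> carrier_mat n n"
    and A: "A \<in> {L..U}" and B: "B \<in> {L..U}"
    and f: "\<And>X D. X \<in> carrier_mat n n \<Longrightarrow> D \<in> carrier_mat n n \<Longrightarrow> f (X + D) \<le> f X + sigma_max D"
    and bounds: "\<And>X. X \<in> {L..U} \<Longrightarrow> f A \<le> f X \<and> f X \<le> f B"
  shows "f ` {L..U} = {f A..f B}"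
proof
  show "f ` {L..U} \<subseteq> {f A..f B}"
  proof (rule image_subsetI)
    fix X assume "X \<in> {L..U}"
    from bounds[OF this] show "f X \<in> {f A..f B}" by simp
  qed
  note A' = interval_mat_carrier[OF A L] and B' = interval_mat_carrier[OF B L]
  show "{f A..f B} \<subseteq> f ` {L..U}"
  proof
    fix y assume "y \<in> {f A..f B}"
    then obtain t where t: "0 \<le> t" "t \<le> 1" "f (A + t \<cdot>\<^sub>m (B - A)) = y"
      using segment_intermediate_value[OF assms(1) A' B' f, of y] by auto
    have "L $$ (i,j) \<le> A $$ (i,j) + t * (B $$ (i,j) - A $$ (i,j)) \<and>
          A $$ (i,j) + t * (B $$ (i,j) - A $$ (i,j)) \<le> U $$ (i,j)" if "i < n" "j < n" for i j
    proof -
      have "A $$ (i,j) + t * (B $$ (i,j) - A $$ (i,j)) = (1 - t) * A $$ (i,j) + t * B $$ (i,j)"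
        by (simp add: algebra_simps)
      moreover have "L $$ (i,j) \<le> A $$ (i,j)" "A $$ (i,j) \<le> U $$ (i,j)"
        "L $$ (i,j) \<le> B $$ (i,j)" "B $$ (i,j) \<le> U $$ (i,j)"
        using interval_mat_entry[OF A L that] interval_mat_entry[OF B L that] by auto
      \<comment> \<open>\<open>convex_bound_le\<close> yields upper bounds; the lower bound is its
        instance for the negated entries.\<close>
      ultimately show ?thesis
        using t convex_bound_le[of "A $$ (i,j)" "U $$ (i,j)" "B $$ (i,j)" "1 - t" t]
          convex_bound_le[of "- A $$ (i,j)" "- L $$ (i,j)" "- B $$ (i,j)" "1 - t" t] by simp
    qed
    then have "A + t \<cdot>\<^sub>m (B - A) \<in> {L..U}"
      using A' B' L U by (auto simp: less_eq_mat_def)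
    then show "y \<in> f ` {L..U}" using t(3) by blast
  qed
qed

section \<open>Monotonicity\<close>

text \<open>Replacing a maximizing vector of \<open>A\<close> by its entrywise modulus keeps the
  norm, and the image of the new vector under \<open>B\<close> dominates the old image entrywise in
  modulus.\<close>

lemma sigma_max_mono:
  assumes "0 < n" and A: "A \<in> carrier_mat n n" and B: "B \<in> carrier_mat n n"
    and AB: "\<And>i j. i < n \<Longrightarrow> j < n \<Longrightarrow> 0 \<le> A $$ (i,j) \<and> A $$ (i,j) \<le> B $$ (i,j)"
  shows "sigma_max A \<le> sigma_max B"
proof -
  obtain x where x: "x \<in> carrier_vec n" "l2norm x = 1" "l2norm (A *\<^sub>v x) = sigma_max A"
    using sigma_max_vector[OF assms(1) A] .
  define y where "y = vec n (\<lambda>i. \<bar>x $ i\<bar>)"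
  have y: "y \<in> carrier_vec n" "l2norm y = 1"
    using x l2norm_cong_abs[of y x] by (auto simp: y_def)
  have "l2norm (A *\<^sub>v x) \<le> l2norm (B *\<^sub>v y)"
  proof (rule l2norm_mono)
    fix i assume "i < dim_vec (B *\<^sub>v y)"
    then have i: "i < n" using B by simp
    have "\<bar>(A *\<^sub>v x) $ i\<bar> \<le> (\<Sum>j<n. \<bar>A $$ (i,j) * x $ j\<bar>)"
      using A x i by (simp add: scalar_prod_def lessThan_atLeast0 sum_abs)
    also have "\<dots> \<le> (\<Sum>j<n. B $$ (i,j) * \<bar>x $ j\<bar>)"
      using AB[OF i] by (intro sum_mono) (simp add: abs_mult mult_right_mono)
    also have "\<dots> = (B *\<^sub>v y) $ i"
      using B i by (simp add: y_def scalar_prod_def lessThan_atLeast0)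
    finally show "\<bar>(A *\<^sub>v x) $ i\<bar> \<le> \<bar>(B *\<^sub>v y) $ i\<bar>" by linarith
  qed (use A B in simp)
  then show ?thesis using le_sigma_max[OF assms(1) B y(1)] x y by simp
qed

text \<open>For square matrices: conjugation by \<open>sign_mat\<close> gives an entrywise
  nonnegative matrix. Differences in this cone define the checkerboard order.\<close>

definition checkerboard :: "real mat \<Rightarrow> bool" where
  "checkerboard A \<longleftrightarrow> (\<forall>i<dim_row A. \<forall>j<dim_col A. 0 \<le> (-1) ^ (i + j) * A $$ (i,j))"

text \<open>In each summand of a product entry the sign of the inner index occurs twice and
  cancels.\<close>

lemma checkerboard_mult:
  assumes "A \<in> carrier_mat n m" "B \<in> carrier_mat m k" "checkerboard A" "checkerboard B"
  shows "checkerboard (A * B)"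
  unfolding checkerboard_def
proof (intro allI impI)
  fix i j assume "i < dim_row (A * B)" "j < dim_col (A * B)"
  then have ij: "i < n" "j < k" using assms by auto
  have "(-1) ^ (i + j) * (A * B) $$ (i,j) =
      (\<Sum>l<m. ((-1) ^ (i + l) * A $$ (i,l)) * ((-1) ^ (l + j) * B $$ (l,j)))"
    using assms ij
    by (auto simp: scalar_prod_def lessThan_atLeast0 sum_distrib_left power_add intro!: sum.cong)
  also have "\<dots> \<ge> 0"
    using assms ij unfolding checkerboard_def
    by (intro sum_nonneg mult_nonneg_nonneg[of "_ * _" "_ * _"]) auto
  finally show "0 \<le> (-1) ^ (i + j) * (A * B) $$ (i,j)" .
qed

text \<open>If \<open>w = C x\<close> for a unit vector \<open>x\<close> with \<open>\<parallel>C x\<parallel> = \<sigma>\<^sub>m\<^sub>i\<^sub>n(C)\<close>, then replacing the signs of \<open>w\<close> by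
  the alternating ones and applying \<open>B\<inverse>\<close> instead of \<open>C\<inverse>\<close> only increases the moduli of the entries of \<open>x\<close>.\<close>

lemma sigma_min_mono:
  assumes "0 < n" and B: "B \<in> carrier_mat n n" and C: "C \<in> carrier_mat n n"
    and BC: "checkerboard (C - B)"
    and B': "B' \<in> carrier_mat n n" "B * B' = 1\<^sub>m n" "B' * B = 1\<^sub>m n" "checkerboard B'"
    and C': "C' \<in> carrier_mat n n" "C * C' = 1\<^sub>m n" "C' * C = 1\<^sub>m n" "checkerboard C'"
  shows "sigma_min B \<le> sigma_min C"
proof -
  have CB: "C - B \<in> carrier_mat n n" using B C by (simp add: minus_carrier_mat)
  have "B' * (C - B) * C' = B' - C'"
  proof -
    have "B' * (C - B) * C' = (B' * C - B' * B) * C'"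
      using B B' C by (simp add: mult_minus_distrib_mat[of _ n n])
    also have "\<dots> = B' * C * C' - 1\<^sub>m n * C'"
      using B B' C C' by (simp add: minus_mult_distrib_mat[of _ n n])
    also have "\<dots> = B' - C'"
      using B' C C' by (simp add: assoc_mult_mat[of _ n n _ n _ n])
    finally show ?thesis .
  qed
  then have "checkerboard (B' - C')"
    using checkerboard_mult[of "B' * (C - B)" n n C' n] checkerboard_mult[of B' n n "C - B" n]
      B' C' BC CB by auto
  then have diff: "(-1) ^ (i + j) * C' $$ (i,j) \<le> (-1) ^ (i + j) * B' $$ (i,j)"
    if "i < n" "j < n" for i j
    using that B' C' by (auto simp: checkerboard_def algebra_simps)
  have absC: "\<bar>C' $$ (i,j)\<bar> = (-1) ^ (i + j) * C' $$ (i,j)" if "i < n" "j < n" for i j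
  proof -
    have "0 \<le> (-1) ^ (i + j) * C' $$ (i,j)"
      using that C' by (auto simp: checkerboard_def)
    then have "\<bar>(-1) ^ (i + j) * C' $$ (i,j)\<bar> = (-1) ^ (i + j) * C' $$ (i,j)" by (rule abs_of_nonneg)
    then show ?thesis by (simp add: abs_mult power_abs)
  qed
  obtain x where x: "x \<in> carrier_vec n" "l2norm x = 1" "l2norm (C *\<^sub>v x) = sigma_min C"
    using sigma_min_vector[OF assms(1) C] .
  define w where "w = C *\<^sub>v x"
  \<comment> \<open>The alternating signs match those of \<open>B'\<close>: in row \<open>i\<close>
    of the product all summands carry the sign \<open>(-1) ^ i\<close>, so their moduli add up
    without cancellation.\<close>
  define w' where "w' = vec n (\<lambda>i. (-1) ^ i * \<bar>w $ i\<bar>)"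
  have w: "w \<in> carrier_vec n" "w' \<in> carrier_vec n" using C x by (auto simp: w_def w'_def)
  have xw: "x = C' *\<^sub>v w"
    using assoc_mult_mat_vec[OF C'(1) C x(1)] C' x by (simp add: w_def)
  have "l2norm x \<le> l2norm (B' *\<^sub>v w')"
  proof (rule l2norm_mono)
    fix i assume "i < dim_vec (B' *\<^sub>v w')"
    then have i: "i < n" using B' by simp
    have "\<bar>x $ i\<bar> \<le> (\<Sum>j<n. \<bar>C' $$ (i,j) * w $ j\<bar>)"
      unfolding xw using C' w i by (simp add: scalar_prod_def lessThan_atLeast0 sum_abs)
    also have "\<dots> \<le> (\<Sum>j<n. (-1) ^ (i + j) * B' $$ (i,j) * \<bar>w $ j\<bar>)"
      using diff[OF i] absC[OF i] by (intro sum_mono) (simp add: abs_mult mult_right_mono)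
    also have "\<dots> = (-1) ^ i * (B' *\<^sub>v w') $ i"
      using B' i
      by (auto simp: w'_def scalar_prod_def lessThan_atLeast0 sum_distrib_left power_add intro!: sum.cong)
    also have "\<dots> \<le> \<bar>(B' *\<^sub>v w') $ i\<bar>"
      using abs_ge_self[of "(-1) ^ i * (B' *\<^sub>v w') $ i"] by (simp add: abs_mult power_abs)
    finally show "\<bar>x $ i\<bar> \<le> \<bar>(B' *\<^sub>v w') $ i\<bar>" .
  qed (use x B' in simp)
  moreover have "B *\<^sub>v (B' *\<^sub>v w') = w'"
    using assoc_mult_mat_vec[OF B B'(1) w(2)] B' w by simp
  moreover have "l2norm w' = sigma_min C"
    using l2norm_cong_abs[of w' w] w(1) x(3) by (simp add: w'_def abs_mult power_abs flip: w_def)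
  \<comment> \<open>\<open>B' *\<^sub>v w'\<close> is the test vector for \<open>B\<close>: its norm
    is at least 1, while its image \<open>w'\<close> has norm \<open>sigma_min C\<close>.\<close>
  ultimately have "sigma_min B * l2norm (B' *\<^sub>v w') \<le> sigma_min C" "1 \<le> l2norm (B' *\<^sub>v w')"
    using sigma_min_le[OF assms(1) B, of "B' *\<^sub>v w'"] B' w x by auto
  moreover have "0 \<le> sigma_min B"
    using sigma_min_vector[OF assms(1) B] l2norm_nonneg by metis
  ultimately show ?thesis
    using mult_left_mono[of 1 "l2norm (B' *\<^sub>v w')" "sigma_min B"] by simp
qed

section \<open>Totally positive matrices\<close>

text \<open>\<open>pick\<close> enumerates an index set increasingly, hence is the identity on an
  initial segment. This exhibits \<open>det A\<close> as a minor.\<close>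

lemma submatrix_full: "submatrix A {..<dim_row A} {..<dim_col A} = A"
proof -
  have "pick {..<m} i = i" if "i < m" for i m :: nat
  proof -
    have "{a \<in> {..<m}. a < i} = {..<i}" using that by auto
    then show ?thesis using pick_card_in_set[of i "{..<m}"] that by simp
  qed
  moreover have "{i. i < m \<and> i \<in> {..<m}} = {..<m}" for m :: nat by auto
  ultimately show ?thesis by (intro eq_matI) (auto simp: submatrix_def)
qed

text \<open>The claimed element is recognized by having exactly \<open>i\<close> smaller members in
  the set.\<close>

lemma pick_delete:
  fixes m k i :: nat
  assumes "k < m" "i < m - 1"
  shows "pick ({..<m} - {k}) i = (if i < k then i else Suc i)"
proof -
  let ?a = "if i < k then i else Suc i"
  have "{b \<in> {..<m} - {k}. b < ?a} = (if i < k then {..<i} else {..i} - {k})"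
    using assms by auto
  then have "card {b \<in> {..<m} - {k}. b < ?a} = i"
    using assms by (simp add: card_Diff_singleton)
  then show ?thesis
    using pick_card_in_set[of ?a "{..<m} - {k}"] assms by auto
qed

text \<open>Bridges cofactors, which are built from \<open>mat_delete\<close>, and total positivity,
  which speaks of \<open>submatrix\<close>.\<close>

lemma mat_delete_eq_submatrix:
  assumes "A \<in> carrier_mat m n" "k < m" "l < n"
  shows "mat_delete A k l = submatrix A ({..<m} - {k}) ({..<n} - {l})"
proof -
  have "{i. i < d \<and> i \<in> {..<d} - {e}} = {..<d} - {e}" for d e :: nat by auto
  then show ?thesis
    using assms
    by (intro eq_matI) (auto simp: mat_delete_def submatrix_def pick_delete card_Diff_singleton)
qed

text \<open>Entries are the minors of order 1.\<close>

lemma totally_positive_entry: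
  assumes "A \<in> carrier_mat m n" "totally_positive A" "i < m" "j < n"
  shows "0 < A $$ (i,j)"
proof -
  have dims: "dim_row A = m" "dim_col A = n" using assms(1) by auto
  have single: "{a. a < d \<and> a \<in> {k}} = {k}" if "k < d" for k d :: nat
    using that by auto
  have carrier: "submatrix A {i} {j} \<in> carrier_mat 1 1"
    unfolding carrier_mat_def mem_Collect_eq dim_submatrix dims single[OF assms(3)] single[OF assms(4)]
    by simp
  have none: "{a \<in> {k}. a < k} = {}" for k :: nat by auto
  have entry: "submatrix A {i} {j} $$ (0,0) = A $$ (i,j)"
    using submatrix_index_card[of i A j "{i}" "{j}"] assms(3,4) dims unfolding none by simp
  have "0 < det (submatrix A {i} {j})"
    using assms(2)[unfolded totally_positive_def, rule_format, of "{i}" "{j}"] assms(3,4) dims by simp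
  then show ?thesis using det_single[of "submatrix A {i} {j}"] carrier entry by simp
qed

text \<open>Each entry of the adjugate is a positive minor times a checkerboard sign, and the
  determinant is positive.\<close>

lemma totally_positive_inverse:
  assumes A: "A \<in> carrier_mat n n" and "0 < n" and tp: "totally_positive A"
  obtains B where "B \<in> carrier_mat n n" "A * B = 1\<^sub>m n" "B * A = 1\<^sub>m n" "checkerboard B"
proof -
  have dims: "dim_row A = n" "dim_col A = n" using A by auto
  note minors = tp[unfolded totally_positive_def dims, rule_format]
  have "{..<n} \<noteq> {}" using assms(2) by auto
  then have "0 < det (submatrix A {..<n} {..<n})"
    by (intro minors conjI subset_refl refl)
  then have det: "0 < det A" using submatrix_full[of A] dims by simp
  have minor: "0 < det (mat_delete A i j)" if ij: "i < n" "j < n" for i j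
  proof (cases "n = 1")
    \<comment> \<open>Deletion leaves the empty matrix, whose index sets
      \<open>totally_positive\<close> excludes; its determinant is 1.\<close>
    case True
    then show ?thesis using mat_delete_carrier[OF A, of i j] by (simp add: det_dim_zero)
  next
    case False
    then have "{..<n} - {i} \<noteq> {}"
      using ij assms(2) by (metis card_Diff_singleton card_lessThan card.empty lessThan_iff
          One_nat_def Suc_pred)
    moreover have "card ({..<n} - {i}) = card ({..<n} - {j})"
      using ij by simp
    ultimately have "0 < det (submatrix A ({..<n} - {i}) ({..<n} - {j}))"
      by (intro minors conjI Diff_subset)
    then show ?thesis using mat_delete_eq_submatrix[OF A ij] by simp
  qed
  let ?B = "(1 / det A) \<cdot>\<^sub>m adj_mat A"
  note adj = adj_mat[OF A]
  show thesis
  proof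
    show "?B \<in> carrier_mat n n" using adj by simp
    have one: "(1 / det A) \<cdot>\<^sub>m (det A \<cdot>\<^sub>m 1\<^sub>m n) = 1\<^sub>m n"
      using det by (intro eq_matI) auto
    show "A * ?B = 1\<^sub>m n"
      using mult_smult_distrib[OF A adj(1)] adj(2) one by simp
    show "?B * A = 1\<^sub>m n"
      using mult_smult_assoc_mat[OF adj(1) A] adj(3) one by simp
    have "0 \<le> (-1) ^ (i + j) * ((1 / det A) * cofactor A j i)" if "i < n" "j < n" for i j
    proof -
      have "(-1) ^ (i + j) * ((1 / det A) * cofactor A j i) = det (mat_delete A j i) / det A"
        by (simp add: cofactor_def add.commute flip: power_add mult.assoc)
      then show ?thesis using minor[of j i] that det by simp
    qed
    then show "checkerboard ?B" using dims by (auto simp: checkerboard_def adj_mat_def)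
  qed
qed

section \<open>The endpoint matrices and the two images\<close>

lemma sign_mat_conj:
  assumes "A \<in> carrier_mat n n"
  shows "sign_mat n * A * sign_mat n = mat n n (\<lambda>(i,j). (-1) ^ (i + j) * A $$ (i,j))"
proof -
  have "sign_mat n * A = mat n n (\<lambda>(i,j). (-1) ^ i * A $$ (i,j))"
    unfolding sign_mat_def by (rule mat_diag_mult_left[OF assms])
  moreover have "\<dots> * sign_mat n = mat n n (\<lambda>(i,j). (-1) ^ (i + j) * A $$ (i,j))"
    unfolding sign_mat_def by (subst mat_diag_mult_right) (auto intro!: eq_matI simp: power_add)
  ultimately show ?thesis by simp
qed

theorem corollary1:
  fixes n :: nat and L U :: "real mat"
  assumes "n \<ge> 1"
    and "L \<in> carrier_mat n n" and "U \<in> carrier_mat n n"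
    and "L \<le> U"
    and "\<And>A. A \<in> {L..U} \<Longrightarrow> totally_positive A"
  shows "sigma_min ` {L..U} = {sigma_min (down_mat L U)..sigma_min (up_mat L U)} \<and>
         sigma_max ` {L..U} = {sigma_max L..sigma_max U}"
proof -
  have n: "0 < n" and L: "L \<in> carrier_mat n n" and U: "U \<in> carrier_mat n n"
    using assms(1-3) by auto
  have carrier: "A \<in> carrier_mat n n" if "A \<in> {L..U}" for A
    using interval_mat_carrier[OF that L] .
  have entries: "L $$ (i,j) \<le> A $$ (i,j) \<and> A $$ (i,j) \<le> U $$ (i,j)"
    if "A \<in> {L..U}" "i < n" "j < n" for A i j
    using interval_mat_entry[OF that(1) L that(2,3)] .
  have LU: "L \<in> {L..U}" "U \<in> {L..U}" using assms(4) by auto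
  have "rad_mat L U \<in> carrier_mat n n"
    using L U by (simp add: rad_mat_def minus_carrier_mat)
  note conj = sign_mat_conj[OF this]
  \<comment> \<open>Conjugation by \<open>sign_mat\<close> negates the radius exactly where
    \<open>i + j\<close> is odd, so every entry is an endpoint of its interval.\<close>
  have down: "down_mat L U = mat n n (\<lambda>(i,j). if even (i + j) then L $$ (i,j) else U $$ (i,j))"
    and up: "up_mat L U = mat n n (\<lambda>(i,j). if even (i + j) then U $$ (i,j) else L $$ (i,j))"
    using L U conj
    by (auto intro!: eq_matI simp: down_mat_def up_mat_def mid_mat_def rad_mat_def field_simps)
  \<comment> \<open>Membership makes both matrices totally positive, so \<open>mono\<close> can
    compare them with any \<open>X\<close>.\<close>
  have du: "down_mat L U \<in> {L..U}" "up_mat L U \<in> {L..U}"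
    using L U entries[OF LU(1)] by (auto simp: down up less_eq_mat_def)
  have mono: "sigma_min A \<le> sigma_min B"
    if "A \<in> {L..U}" "B \<in> {L..U}" "checkerboard (B - A)" for A B
    using sigma_min_mono[OF n carrier[OF that(1)] carrier[OF that(2)] that(3)]
      totally_positive_inverse[OF carrier[OF that(1)] n assms(5)[OF that(1)]]
      totally_positive_inverse[OF carrier[OF that(2)] n assms(5)[OF that(2)]] by metis
  have "sigma_min ` {L..U} = {sigma_min (down_mat L U)..sigma_min (up_mat L U)}"
  proof (rule image_interval_mat[OF n L U du sigma_min_add_le[OF n]])
    fix X assume X: "X \<in> {L..U}"
    have "checkerboard (X - down_mat L U)" "checkerboard (up_mat L U - X)"
      using entries[OF X] carrier[OF X] by (auto simp: checkerboard_def down up)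
    then show "sigma_min (down_mat L U) \<le> sigma_min X \<and> sigma_min X \<le> sigma_min (up_mat L U)"
      using mono du X by blast
  qed
  moreover have "sigma_max ` {L..U} = {sigma_max L..sigma_max U}"
  proof (rule image_interval_mat[OF n L U LU sigma_max_add_le[OF n]])
    fix X assume X: "X \<in> {L..U}"
    have pos: "0 \<le> Y $$ (i,j)" if "Y \<in> {L..U}" "i < n" "j < n" for Y i j
      using totally_positive_entry[OF carrier assms(5)] that by (simp add: less_imp_le)
    show "sigma_max L \<le> sigma_max X \<and> sigma_max X \<le> sigma_max U"
      using sigma_max_mono[OF n L carrier[OF X]] sigma_max_mono[OF n carrier[OF X] U]
        entries[OF X] pos[OF LU(1)] pos[OF X] by simp
  qed
  ultimately show ?thesis by blast
qed

end
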